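(* Let $(X,\|\cdot\|)$ be a Banach space and let $I\in C^1(X,\mathbb{R})$ be a functional of the form $I(u)=A(u)-B(u)$ for all $u\in X$, satisfying conditions (A) and ($\Psi$) stated in the context, with $\{\psi_n\}\subset C(X,X)$ the sequence of mappings in ($\Psi$). Let $(M,d)$ be a metric space and $M_0\subset M$ a compact subspace such that there exist $\varepsilon_0>0$ and $\sigma\in C(M,M)$ satisfying i) $\sigma$ is uniformly continuous on $M_0^{\varepsilon_0}:=\{p\in M: d(p,M_0)\le\varepsilon_0\}$; ii) $\sigma(M_0^{\varepsilon_0})\subseteq M_0$; iii) $\sigma_{|M_0}=\mathrm{id}$. Let $\Gamma_0\subset C(M_0,X)$ be such that $\bigcup_{\gamma_0\in\Gamma_0}\gamma_0(M_0)$ is compact and define $\Gamma:=\{\gamma\in C(M,X):\gamma_{|M_0}\in\Gamma_0\}$. Assume that $$\sup_{\gamma_0\in\Gamma_0}\max_{u\in\gamma_0(M_0)}I(u)<c:=\inf_{\gamma\in\Gamma}\sup_{u\in\gamma(M)}I(u)<\infty$$ and $$\lim_{n\to\infty}\ \sup_{\gamma_0\in\Gamma_0}\max_{u\in\gamma_0(M_0)}\|\psi_n(u)-u\|=0.$$ Then there exists a sequence $\{w_n\}\subset X$ such that $$I(w_n)\to c,\qquad I'(w_n)\to 0\ \text{in } X',\qquad \sup_n A(w_n)<\infty.$$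
   Context: $X'$ denotes the dual space of $X$, $C(S,T)$ is the set of continuous maps from $S$ to $T$, and $A,B:X\to\mathbb{R}$ are functions. $d(p,M_0):=\inf_{q\in M_0}d(p,q)$. For $l\in\mathbb{R}$ put $A^{l}:=\{u\in X:A(u)\le l\}$, and $\mathrm{dist}(u,A^{l}):=\inf_{h\in A^{l}}\|u-h\|$. Condition (A): $A$ is nonnegative and for all $l_2>l_1>0$ there exists $\delta_{l_1,l_2}>0$ such that for all $u\in X$, $\mathrm{dist}(u,A^{l_1})\le\delta_{l_1,l_2}$ implies $u\in A^{l_2}$. Condition ($\Psi$): there exists a sequence of mappings $\{\psi_n\}\subset C(X,X)$ such that for every $n$ there exist $\alpha_n>\beta_n>0$ satisfying ($\Psi$1) $A(u)\ge\alpha_n A(\psi_n(u))$ and $B(u)\le\beta_n B(\psi_n(u))$ for all $u\in X$; ($\Psi$2) $\lim_{n\to\infty}\alpha_n=\lim_{n\to\infty}\beta_n=1$ and $\liminf_{n\to\infty}\dfrac{|1-\beta_n|}{\alpha_n-\beta_n}<\infty$. *)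

theory Defs
  imports "HOL-Analysis.Analysis"
begin

text \<open>
  Distance from a point to a set, valued in the extended reals so that the distance to the
  empty set is \<open>\<infinity>\<close>. The library's \<open>infdist x {} = 0\<close> would change condition (A) below for
  those levels \<open>l\<close> at which the sublevel set is empty.
\<close>

definition dist_set :: "'a::metric_space \<Rightarrow> 'a set \<Rightarrow> ereal" where
  "dist_set x S = (INF y\<in>S. ereal (dist x y))"

definition sublevel :: "('a \<Rightarrow> real) \<Rightarrow> real \<Rightarrow> 'a set" where
  "sublevel A l = {u. A u \<le> l}"

definition condition_A :: "('a::real_normed_vector \<Rightarrow> real) \<Rightarrow> bool" where
  "condition_A A \<longleftrightarrow>
     (\<forall>u. 0 \<le> A u) \<and>
     (\<forall>l1 l2. 0 < l1 \<and> l1 < l2 \<longrightarrow>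
        (\<exists>\<delta>>0. \<forall>u. dist_set u (sublevel A l1) \<le> ereal \<delta> \<longrightarrow> u \<in> sublevel A l2))"

definition condition_Psi ::
  "('a::real_normed_vector \<Rightarrow> real) \<Rightarrow> ('a \<Rightarrow> real) \<Rightarrow> (nat \<Rightarrow> 'a \<Rightarrow> 'a) \<Rightarrow> bool" where
  "condition_Psi A B \<psi> \<longleftrightarrow>
     (\<forall>n. continuous_on UNIV (\<psi> n)) \<and>
     (\<exists>\<alpha> \<beta> :: nat \<Rightarrow> real.
        (\<forall>n. \<alpha> n > \<beta> n \<and> \<beta> n > 0) \<and>
        (\<forall>n u. A u \<ge> \<alpha> n * A (\<psi> n u) \<and> B u \<le> \<beta> n * B (\<psi> n u)) \<and>
        \<alpha> \<longlonglongrightarrow> 1 \<and> \<beta> \<longlonglongrightarrow> 1 \<and>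
        liminf (\<lambda>n. ereal (\<bar>1 - \<beta> n\<bar> / (\<alpha> n - \<beta> n))) < \<infinity>)"

text \<open>The closed neighbourhood \<open>M\<^sub>0\<^sup>\<epsilon>\<close> of a set \<open>M\<^sub>0\<close>.\<close>

definition nbhd :: "'m::metric_space set \<Rightarrow> real \<Rightarrow> 'm set" where
  "nbhd M0 \<epsilon> = {p. dist_set p M0 \<le> ereal \<epsilon>}"

text \<open>
  The space \<open>C(S, X)\<close> for a subspace \<open>S\<close>: its elements are represented by total functions that
  are \<open>undefined\<close> outside \<open>S\<close>, so that equality of functions is equality on \<open>S\<close>, and the
  restriction of \<open>\<gamma>\<close> to \<open>S\<close> is \<open>restrict \<gamma> S\<close>.
\<close>

definition cont_maps :: "'m::topological_space set \<Rightarrow> ('m \<Rightarrow> 'a::topological_space) set" where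
  "cont_maps S = {f \<in> extensional S. continuous_on S f}"

definition extensions ::
  "'m::topological_space set \<Rightarrow> ('m \<Rightarrow> 'a::topological_space) set \<Rightarrow> ('m \<Rightarrow> 'a) set" where
  "extensions M0 \<Gamma>0 = {\<gamma>. continuous_on UNIV \<gamma> \<and> restrict \<gamma> M0 \<in> \<Gamma>0}"

text \<open>The supremum of \<open>I\<close> over \<open>\<gamma>(M)\<close> may be infinite, hence the extended reals.\<close>

definition minimax_level :: "('a \<Rightarrow> real) \<Rightarrow> ('m \<Rightarrow> 'a) set \<Rightarrow> ereal" where
  "minimax_level I \<Gamma> = (INF \<gamma>\<in>\<Gamma>. SUP u\<in>range \<gamma>. ereal (I u))"

end

theory Submission
  imports Defs
begin

text \<open>
  The sequence is a Palais-Smale sequence at the minimax level \<open>c\<close> along which \<open>A\<close> stays bounded.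
  It suffices to find a bound \<open>L\<close> such that every \<open>\<epsilon> > 0\<close> admits a point with value
  within \<open>\<epsilon>\<close> of \<open>c\<close>, derivative of norm below \<open>\<epsilon>\<close>, and \<open>A \<le> L\<close>.

  Where the bound comes from: take a path \<open>\<gamma>\<close> in \<open>\<Gamma>\<close> staying below the level
  \<open>c + (\<alpha>\<^sub>n - \<beta>\<^sub>n)\<close> and rescale it to \<open>\<psi>\<^sub>n \<circ> \<gamma>\<close>. By \<open>rescaled_level_bounds\<close> the new path still stays
  below a level tending to \<open>c\<close>, and each of its points whose value is nearly \<open>c\<close> or larger
  satisfies \<open>A \<le> K\<close>, where \<open>K\<close> is independent of the path and of \<open>n\<close> as long as the quotients
  \<open>\<bar>1 - \<beta>\<^sub>n\<bar> / (\<alpha>\<^sub>n - \<beta>\<^sub>n)\<close> stay bounded; that happens for infinitely many \<open>n\<close>. Condition (A) turns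
  \<open>A \<le> K\<close> at a point into \<open>A \<le> K + 1\<close> on a ball of a fixed radius \<open>\<delta>\<close> around it.

  If \<open>L = K + 1\<close> failed for some \<open>\<epsilon>\<close>, the functional would be steep on these balls near the level
  \<open>c\<close>, so a deformation moving points by at most \<open>\<delta>\<close> would push the rescaled path below \<open>c\<close>
  (\<open>local_deformation\<close>). To remain in \<open>\<Gamma>\<close>, the rescaled path is first corrected
  near \<open>M0\<close>, with the help of the retraction \<open>\<sigma>\<close> (\<open>glue_near_compact\<close>). The correction stays
  close to the compact set of boundary values, on which \<open>I\<close> is below \<open>c\<close>, and low points are
  not moved by the deformation. This contradicts the definition of \<open>c\<close>.

  The parameter space is not compact and \<open>dI\<close> is merely continuous, so neither a uniform step
  size nor a flow is at hand. The deformation is the end point of an Euler polygon along a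
  continuous pseudo-gradient field (\<open>continuous_pseudogradient\<close>, from a selection theorem) whose
  step size adapts continuously to the base point (\<open>euler_polygon_endpoint\<close>).
\<close>

section \<open>Continuous selections\<close>

text \<open>
  A Michael-type selection theorem. Constant values that are good near one point are averaged
  with continuous weights. The weights avoid paracompactness: let \<open>f a\<close> be a bump
  around \<open>a\<close>, well-order the points, and let \<open>S a\<close> be the supremum of the bumps before \<open>a\<close>.
  At the scale \<open>q n\<close> the weight \<open>g n a\<close> lives where \<open>f a > 2 q n\<close> but \<open>S a < q n\<close>. All bumps are
  1-Lipschitz, so the supports belonging to different \<open>a\<close> are more than \<open>q n\<close> apart, and near
  each point at most one index matters at each scale. Every point \<open>x\<close> receives some weight, namely
  from the first \<open>a\<close> with \<open>f a x > 0\<close>, for which \<open>S a x = 0\<close>. The scales are summed with factors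
  \<open>(1/2)^n\<close>; the average stays in \<open>\<Phi> x\<close> because that set is convex and closed.
\<close>

lemma continuous_selection:
  fixes \<Phi> :: "'a::metric_space \<Rightarrow> 'b::banach set"
  assumes conv: "\<And>x. convex (\<Phi> x)" and clo: "\<And>x. closed (\<Phi> x)"
    and bdd: "\<And>x v. v \<in> \<Phi> x \<Longrightarrow> norm v \<le> 1"
    and loc: "\<And>a. \<exists>v. \<exists>r>0. \<forall>x\<in>ball a r. v \<in> \<Phi> x"
  obtains V where "continuous_on UNIV V" "\<And>x. V x \<in> \<Phi> x"
proof -
  have "\<exists>v r. 0 < r \<and> r \<le> 1 \<and> (\<forall>x\<in>ball a r. v \<in> \<Phi> x)" for a
  proof -
    obtain v r where "r > 0" "\<forall>x\<in>ball a r. v \<in> \<Phi> x" using loc by blast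
    then show ?thesis by (intro exI[of _ v] exI[of _ "min r 1"]) auto
  qed
  then obtain v r where r0: "\<And>a. 0 < r a" and r1: "\<And>a. r a \<le> 1"
    and vr: "\<And>a x. x \<in> ball a (r a) \<Longrightarrow> v a \<in> \<Phi> x" by metis
  define f where "f a x = max 0 (r a - dist a x)" for a x
  have f1: "f a x \<le> 1" for a x
    using r1[of a] zero_le_dist[of a x] by (auto simp: f_def simp del: zero_le_dist)
  have fL: "f a x \<le> f a y + dist x y" for a x y
    using dist_triangle[of a y x] by (auto simp: f_def dist_commute)
  obtain R :: "'a rel" where R: "well_order_on UNIV R" using well_order_on by blast
  define P where "P = R - Id"
  have wfP: "wf P" using R by (simp add: P_def well_order_on_def)
  have totP: "a \<noteq> b \<Longrightarrow> (a,b) \<in> P \<or> (b,a) \<in> P" for a b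
    using R by (auto simp: P_def well_order_on_def linear_order_on_def total_on_def)
  define S where "S a x = Sup (insert 0 ((\<lambda>b. f b x) ` {b. (b,a) \<in> P}))" for a x
  have bddS: "bdd_above (insert 0 ((\<lambda>b. f b x) ` {b. (b,a) \<in> P}))" for a x
    using f1 by (intro bdd_aboveI[of _ 1]) auto
  have S0: "0 \<le> S a x" for a x unfolding S_def by (rule cSup_upper[OF _ bddS]) simp
  have fS: "f b x \<le> S a x" if "(b,a) \<in> P" for a b x
    unfolding S_def by (rule cSup_upper[OF _ bddS]) (use that in auto)
  have SL: "S a x \<le> S a y + dist x y" for a x y
    unfolding S_def[of a x]
  proof (rule cSup_least)
    fix z assume "z \<in> insert 0 ((\<lambda>b. f b x) ` {b. (b,a) \<in> P})"
    then show "z \<le> S a y + dist x y"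
      using S0[of a y] fS[of _ a y] fL[of _ x y] by (fastforce intro: order_trans)
  qed simp
  have contL: "continuous_on UNIV F" if "\<And>x y. F x \<le> F y + dist x y" for F :: "'a \<Rightarrow> real"
  proof -
    have "dist (F x) (F y) \<le> dist x y" for x y
      using that[of x y] that[of y x] by (simp add: dist_real_def dist_commute abs_le_iff algebra_simps)
    then show ?thesis unfolding continuous_on_iff by (meson le_less_trans)
  qed
  have fc: "continuous_on UNIV (f a)" and Sc: "continuous_on UNIV (S a)" for a
    by (intro contL fL SL)+
  define q where "q n = inverse (real (Suc n))" for n
  have q0: "0 < q n" and q1: "q n \<le> 1" for n by (auto simp: q_def field_simps)
  define g where "g n a x = max 0 (min (f a x - 2 * q n) (q n - S a x))" for n a x
  have gc: "continuous_on UNIV (g n a)" for n a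
    unfolding g_def by (intro continuous_intros fc Sc)
  have g0: "0 \<le> g n a x" and g1: "g n a x \<le> 1" for n a x
    using f1[of a x] q0[of n] by (auto simp: g_def)
  have gpos: "g n a x \<noteq> 0 \<longleftrightarrow> f a x > 2 * q n \<and> S a x < q n" for n a x
    by (auto simp: g_def max_def min_def)
  have sep1: "dist x y > q n" if "g n a x \<noteq> 0" "g n b y \<noteq> 0" "(a,b) \<in> P" for n a b x y
    using that(1,2) fS[OF that(3), of y] fL[of a x y] by (auto simp: gpos)
  have sep: "a = b" if "g n a x \<noteq> 0" "g n b y \<noteq> 0" "dist x y \<le> q n" for n a b x y
    using sep1[OF that(1,2)] sep1[OF that(2,1)] totP[of a b] that(3) by (fastforce simp: dist_commute)
  have gPhi: "v a \<in> \<Phi> x" if "g n a x \<noteq> 0" for n a x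
    using that q0[of n] vr[of x a] by (auto simp: gpos f_def max_def split: if_splits)
  define h where "h n w x = (\<Sum>a | g n a x \<noteq> 0. g n a x *\<^sub>R w a)" for n and w :: "'a \<Rightarrow> 'b \<times> real" and x
  have hloc: "\<exists>a. \<forall>x\<in>ball z (q n / 2). {b. g n b x \<noteq> 0} \<subseteq> {a}" for n z
  proof (cases "\<exists>a. \<exists>y\<in>ball z (q n / 2). g n a y \<noteq> 0")
    case True
    then obtain a y where a: "y \<in> ball z (q n / 2)" "g n a y \<noteq> 0" by blast
    have "b = a" if "x \<in> ball z (q n / 2)" "g n b x \<noteq> 0" for x b
      using sep[OF that(2) a(2)] that(1) a(1) dist_triangle[of x y z] by (auto simp: dist_commute)
    then show ?thesis by blast
  next
    case False then show ?thesis by blast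
  qed
  have heq: "h n w x = g n a x *\<^sub>R w a" if "{b. g n b x \<noteq> 0} \<subseteq> {a}" for n w x a
  proof -
    have "h n w x = (\<Sum>b\<in>{a}. g n b x *\<^sub>R w b)"
      unfolding h_def by (rule sum.mono_neutral_left) (use that in auto)
    then show ?thesis by simp
  qed
  have hc: "continuous_on UNIV (h n w)" for n w
  proof -
    have "continuous_on (ball z (q n / 2)) (h n w)" for z
    proof -
      obtain a where a: "\<forall>x\<in>ball z (q n / 2). {b. g n b x \<noteq> 0} \<subseteq> {a}" using hloc by blast
      have "continuous_on (ball z (q n / 2)) (\<lambda>x. g n a x *\<^sub>R w a)"
        by (intro continuous_intros continuous_on_subset[OF gc]) auto
      then show ?thesis by (rule continuous_on_eq) (rule heq[symmetric], use a in blast)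
    qed
    then have "continuous_on (\<Union>z. ball z (q n / 2)) (h n w)"
      by (intro continuous_on_open_UN) auto
    moreover have "(\<Union>z::'a. ball z (q n / 2)) = UNIV" using q0[of n] by auto
    ultimately show ?thesis by (simp only:)
  qed
  \<comment> \<open>The second component carries the total weight, so one series yields numerator and denominator.\<close>
  define w where "w a = (v a, 1::real)" for a
  have hform: "\<exists>a s. 0 \<le> s \<and> s \<le> 1 \<and> v a \<in> \<Phi> x \<and> h n w x = s *\<^sub>R w a" for n x
  proof -
    have "x \<in> ball x (q n / 2)" using q0[of n] by simp
    then obtain a where a: "{b. g n b x \<noteq> 0} \<subseteq> {a}" using hloc[of x n] by blast
    show ?thesis
    proof (cases "g n a x = 0")
      case True
      \<comment> \<open>A vanishing term may be charged to any index whose vector is admissible at \<open>x\<close>; \<open>x\<close> itself is one.\<close>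
      have "v x \<in> \<Phi> x" using vr[of x x] r0[of x] by simp
      then show ?thesis using heq[OF a, of w] True by (intro exI[of _ x] exI[of _ 0]) auto
    next
      case False
      then show ?thesis using heq[OF a, of w] gPhi[OF False] g0 g1 by blast
    qed
  qed
  define Q where "Q n x a s \<longleftrightarrow> 0 \<le> s \<and> s \<le> 1 \<and> v a \<in> \<Phi> x \<and> h n w x = s *\<^sub>R w a" for n x a s
  obtain k s where "\<And>n x. Q n x (k n x) (s n x)" using hform unfolding Q_def[symmetric] by metis
  then have s0: "0 \<le> s n x" and s1: "s n x \<le> 1" and kPhi: "v (k n x) \<in> \<Phi> x"
    and hk: "h n w x = s n x *\<^sub>R w (k n x)" for n x
    unfolding Q_def by blast+
  have spos: "\<exists>n. s n x > 0" for x
  proof -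
    have "x \<in> {a. f a x > 0}" using r0[of x] by (simp add: f_def)
    from wfP[unfolded wf_eq_minimal, rule_format, OF this]
    obtain a where a: "f a x > 0" "\<And>b. (b,a) \<in> P \<Longrightarrow> \<not> f b x > 0" by auto
    have "S a x \<le> 0" unfolding S_def by (rule cSup_least) (use a(2) in \<open>auto simp: not_less\<close>)
    obtain n where n: "inverse (real (Suc n)) < f a x / 2" using reals_Archimedean[of "f a x / 2"] a(1) by auto
    then have "2 * q n < f a x" by (simp add: q_def)
    moreover have "S a x < q n" using \<open>S a x \<le> 0\<close> q0[of n] by linarith
    ultimately have ga: "g n a x \<noteq> 0" by (simp only: gpos simp_thms)
    have "b = a" if "g n b x \<noteq> 0" for b using sep[OF that ga] q0[of n] by simp
    then have "{b. g n b x \<noteq> 0} \<subseteq> {a}" by blast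
    then have "h n w x = g n a x *\<^sub>R w a" by (rule heq)
    then have "snd (h n w x) = g n a x" by (simp add: w_def)
    moreover have "snd (h n w x) = s n x" unfolding hk by (simp add: w_def)
    ultimately show ?thesis using ga g0[of n a x] by (intro exI[of _ n]) auto
  qed
  define H where "H N x = (\<Sum>n<N. (1/2)^n *\<^sub>R h n w x)" for N x
  define L where "L x = (\<Sum>n. (1/2)^n *\<^sub>R h n w x)" for x
  have nw: "norm (w (k n x)) \<le> 2" for n x
    using norm_Pair_le[of "v (k n x)" "1::real"] bdd[OF kPhi[of n x]] by (simp add: w_def)
  have hb: "norm ((1/2)^n *\<^sub>R h n w x) \<le> 2 * (1/2::real)^n" for n x
  proof -
    have "norm (h n w x) \<le> 1 * 2" unfolding hk norm_scaleR
      by (rule mult_mono) (use s0 s1 nw in auto)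
    then show ?thesis by (simp add: field_simps)
  qed
  have ul: "uniform_limit UNIV H L sequentially"
    unfolding H_def L_def
    by (rule Weierstrass_m_test[OF hb]) (intro summable_mult summable_geometric, simp)
  have Lc: "continuous_on UNIV L"
    by (rule uniform_limit_theorem[OF _ ul])
       (auto intro!: always_eventually continuous_intros hc simp: H_def)
  have HL: "(\<lambda>N. H N x) \<longlonglongrightarrow> L x" for x using tendsto_uniform_limitI[OF ul] by simp
  have sndH: "snd (H N x) = (\<Sum>n<N. (1/2)^n * s n x)" for N x
    by (simp add: H_def snd_sum hk w_def)
  have fstH: "fst (H N x) = (\<Sum>n<N. ((1/2)^n * s n x) *\<^sub>R v (k n x))" for N x
    by (simp add: H_def fst_sum hk w_def)
  have ev: "\<exists>d>0. \<forall>\<^sub>F N in sequentially. d \<le> snd (H N x)" for x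
  proof -
    obtain n where n: "s n x > 0" using spos by blast
    have "(1/2)^n * s n x \<le> snd (H N x)" if "N \<ge> Suc n" for N
      unfolding sndH by (rule member_le_sum) (use that s0 in auto)
    then show ?thesis using n by (intro exI[of _ "(1/2)^n * s n x"]) (auto simp: eventually_sequentially)
  qed
  have sndL: "snd (L x) > 0" for x
  proof -
    obtain d where d: "d > 0" "\<forall>\<^sub>F N in sequentially. d \<le> snd (H N x)" using ev by blast
    have "d \<le> snd (L x)"
      by (rule tendsto_lowerbound[OF tendsto_snd[OF HL]]) (use d in auto)
    then show ?thesis using d by simp
  qed
  define V where "V x = (1 / snd (L x)) *\<^sub>R fst (L x)" for x
  show ?thesis
  proof
    have "snd (L x) \<noteq> 0" for x using sndL[of x] by simp
    then show "continuous_on UNIV V" unfolding V_def by (intro continuous_intros Lc) auto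
    fix x
    have lim: "(\<lambda>N. (1 / snd (H N x)) *\<^sub>R fst (H N x)) \<longlonglongrightarrow> V x"
      unfolding V_def using sndL[of x] by (intro tendsto_intros HL) auto
    have inPhi: "(1 / snd (H N x)) *\<^sub>R fst (H N x) \<in> \<Phi> x" if "snd (H N x) > 0" for N
    proof -
      have "(\<Sum>n<N. ((1/2)^n * s n x / snd (H N x)) *\<^sub>R v (k n x)) \<in> \<Phi> x"
      proof (rule convex_sum[OF _ conv])
        show "(\<Sum>n<N. (1/2)^n * s n x / snd (H N x)) = 1"
          using that by (simp add: sum_divide_distrib[symmetric] sndH)
      qed (use s0 that kPhi in auto)
      then show ?thesis by (simp add: fstH scaleR_sum_right)
    qed
    show "V x \<in> \<Phi> x"
      by (rule Lim_in_closed_set[OF clo _ _ lim])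
         (use ev[of x] inPhi in \<open>auto elim!: eventually_mono intro: less_le_trans\<close>)
  qed
qed

section \<open>Euler polygons with adaptive steps\<close>

text \<open>
  The local oscillation of \<open>F\<close> is controlled on a radius that varies continuously: half the
  distance of the diagonal point \<open>(u, u)\<close> from the closed set of pairs on which \<open>F\<close> differs by at
  least \<open>e\<close>.
\<close>

lemma continuous_modulus:
  fixes F :: "'a::metric_space \<Rightarrow> 'b::metric_space"
  assumes cF: "continuous_on UNIV F" and e: "e > 0"
  obtains \<tau> :: "'a \<Rightarrow> real" where "continuous_on UNIV \<tau>" "\<And>u. 0 < \<tau> u"
    "\<And>u v. dist u v \<le> \<tau> u \<Longrightarrow> dist (F u) (F v) < e"
proof (cases "\<exists>v w. e \<le> dist (F v) (F w)")
  case False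
  then show ?thesis by (intro that[of "\<lambda>_. 1"]) (auto simp: not_le)
next
  case True
  define P where "P = {(v, w). e \<le> dist (F v) (F w)}"
  have "closed P" unfolding P_def case_prod_beta
    by (intro closed_Collect_le continuous_intros continuous_on_compose2[OF cF]) auto
  have pos: "0 < infdist (u, u) P" for u
    by (rule infdist_pos_not_in_closed[OF \<open>closed P\<close>]) (use True e in \<open>auto simp: P_def\<close>)
  show ?thesis
  proof (rule that[of "\<lambda>u. infdist (u, u) P / 2"])
    show "continuous_on UNIV (\<lambda>u. infdist (u, u) P / 2)" by (intro continuous_intros) auto
    fix u v assume "dist u v \<le> infdist (u, u) P / 2"
    then have "dist (u, u) (u, v) < infdist (u, u) P" using pos[of u] by (simp add: dist_Pair_Pair)
    then have "(u, v) \<notin> P" using infdist_le[of "(u, v)" P "(u, u)"] by linarith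
    then show "dist (F u) (F v) < e" by (simp add: P_def)
  qed (use pos in auto)
qed

text \<open>
  The state is a pair of the remaining time and the current point. Carrying the remaining time
  makes the last step land exactly at time zero, after which the state no longer changes.
\<close>

definition euler_step :: "('a \<Rightarrow> real) \<Rightarrow> ('a \<Rightarrow> 'a) \<Rightarrow> real \<times> 'a \<Rightarrow> real \<times> ('a::real_normed_vector)" where
  "euler_step \<tau> V = (\<lambda>(r, u). (r - min r (\<tau> u), u - min r (\<tau> u) *\<^sub>R V u))"

text \<open>
  This replaces the flow of \<open>-V\<close> and needs only continuity of \<open>V\<close>. The polygon uses up all its
  time in finitely many steps: otherwise every step has length \<open>\<tau>\<close> of its base point, these
  lengths are summable, so the base points form a Cauchy sequence, and at its limit \<open>\<tau>\<close> would vanish.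
  Some step \<open>k\<close> therefore satisfies \<open>r k u < \<tau> (p k u)\<close> and uses up the remaining time. This
  inequality is an open condition on \<open>u\<close>, so the number of steps is locally bounded and the end
  point depends continuously on the start.
\<close>

lemma euler_polygon_endpoint:
  fixes V :: "'a::banach \<Rightarrow> 'a"
  assumes cV: "continuous_on UNIV V" and nV: "\<And>u. norm (V u) \<le> 1"
    and c\<tau>: "continuous_on UNIV \<tau>" and \<tau>0: "\<And>u. 0 < \<tau> u" and T: "0 \<le> T"
  obtains \<Phi> where "continuous_on UNIV \<Phi>" "\<And>u. \<exists>k. (euler_step \<tau> V ^^ k) (T, u) = (0, \<Phi> u)"
proof -
  let ?S = "euler_step \<tau> V"
  define r where "r k u = fst ((?S ^^ k) (T, u))" for k u
  define p where "p k u = snd ((?S ^^ k) (T, u))" for k u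
  define h where "h k u = min (r k u) (\<tau> (p k u))" for k u
  have rp: "(?S ^^ k) (T, u) = (r k u, p k u)" for k u by (simp add: r_def p_def)
  have zero: "r 0 u = T" "p 0 u = u" for u by (simp_all add: r_def p_def)
  have "(?S ^^ Suc k) (T, u) = ?S (r k u, p k u)" for k u by (simp add: rp)
  then have "(?S ^^ Suc k) (T, u) = (r k u - h k u, p k u - h k u *\<^sub>R V (p k u))" for k u
    by (simp only: euler_step_def h_def prod.case)
  then have suc: "r (Suc k) u = r k u - h k u" "p (Suc k) u = p k u - h k u *\<^sub>R V (p k u)" for k u
    unfolding r_def[of "Suc k"] p_def[of "Suc k"] by simp_all
  have r0: "0 \<le> r k u" for k u
    by (induction k) (use T in \<open>auto simp: zero suc h_def\<close>)
  have h0: "0 \<le> h k u" for k u using r0[of k u] \<tau>0[of "p k u"] by (simp add: h_def)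
  have cS: "continuous_on UNIV ?S"
    unfolding euler_step_def case_prod_beta
    by (intro continuous_intros continuous_on_compose2[OF cV] continuous_on_compose2[OF c\<tau>]) auto
  have ck: "continuous_on UNIV (\<lambda>u. (?S ^^ k) (T, u))" for k
  proof (induction k)
    case 0 show ?case by (auto intro!: continuous_intros)
  next
    case (Suc k)
    show ?case using continuous_on_compose2[OF cS Suc.IH] by simp
  qed
  have rc: "continuous_on UNIV (r k)" and pc: "continuous_on UNIV (p k)" for k
    unfolding r_def p_def by (intro continuous_intros ck)+
  have "\<exists>k. r k u < \<tau> (p k u)" for u
  proof (rule ccontr)
    assume "\<not> ?thesis"
    then have h\<tau>: "h k u = \<tau> (p k u)" for k by (simp add: h_def not_less min_def) (meson order_antisym)
    have dec: "decseq (\<lambda>k. r k u)" using h0 by (intro decseq_SucI) (simp add: suc)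
    obtain R where R: "(\<lambda>k. r k u) \<longlonglongrightarrow> R"
      using decseq_convergent[OF dec, of 0] r0 by blast
    have pd: "dist (p j u) (p (j + i) u) \<le> r j u - r (j + i) u" for i j
    proof (induction i)
      case (Suc i)
      have "dist (p (j + i) u) (p (j + Suc i) u) = h (j + i) u * norm (V (p (j + i) u))"
        using h0[of "j + i" u] by (simp add: suc dist_norm)
      also have "\<dots> \<le> h (j + i) u" using h0[of "j + i" u] nV by (simp add: mult_left_le)
      finally show ?case using Suc dist_triangle[of "p j u" "p (j + Suc i) u" "p (j + i) u"]
        by (simp add: suc)
    qed simp
    have "Cauchy (\<lambda>k. p k u)"
    proof (rule metric_CauchyI)
      fix e :: real assume "e > 0"
      obtain N where N: "\<And>k. k \<ge> N \<Longrightarrow> dist (r k u) R < e / 2"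
        using R \<open>e > 0\<close> unfolding lim_sequentially by (meson half_gt_zero)
      have near: "dist (p N u) (p k u) < e / 2" if "k \<ge> N" for k
      proof -
        have "R \<le> r k u" using decseq_ge[OF dec R] .
        moreover have "dist (p N u) (p k u) \<le> r N u - r k u" using pd[of N "k - N"] that by simp
        moreover have "r N u - R < e / 2" using N[OF order_refl] by (simp only: dist_real_def abs_less_iff)
        ultimately show ?thesis by linarith
      qed
      show "\<exists>M. \<forall>m\<ge>M. \<forall>n\<ge>M. dist (p m u) (p n u) < e"
        using near by (meson dist_triangle_half_r)
    qed
    then obtain q where q: "(\<lambda>k. p k u) \<longlonglongrightarrow> q" using Cauchy_convergent_iff convergent_def by blast
    have "(\<lambda>k. \<tau> (p k u)) \<longlonglongrightarrow> \<tau> q"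
      using continuous_on_tendsto_compose[OF c\<tau> q] by simp
    moreover have "(\<lambda>k. r k u - r (Suc k) u) \<longlonglongrightarrow> R - R"
      by (intro tendsto_diff R LIMSEQ_Suc[OF R])
    moreover have "r k u - r (Suc k) u = \<tau> (p k u)" for k by (simp add: suc h\<tau>)
    ultimately have "\<tau> q = 0" using LIMSEQ_unique by fastforce
    then show False using \<tau>0[of q] by simp
  qed
  then obtain N where N: "\<And>u. r (N u) u < \<tau> (p (N u) u)" by metis
  have stop: "r (Suc k + i) u = 0 \<and> p (Suc k + i) u = p (Suc k) u" if "r k u < \<tau> (p k u)" for k i u
  proof (induction i)
    case 0 show ?case using that by (simp add: suc h_def)
  next
    case (Suc i)
    then have "h (Suc k + i) u = 0" using \<tau>0[of "p (Suc k + i) u"] by (simp add: h_def)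
    then show ?case using Suc suc[of "Suc k + i" u] by simp
  qed
  define \<Phi> where "\<Phi> u = p (Suc (N u)) u" for u
  have \<Phi>eq: "\<Phi> u = p (Suc k) u" if "r k u < \<tau> (p k u)" for k u
  proof (cases "k \<le> N u")
    case True then show ?thesis using stop[OF that, of "N u - k"] by (simp add: \<Phi>_def)
  next
    case False then show ?thesis using stop[OF N[of u], of "k - N u"] by (simp add: \<Phi>_def)
  qed
  show ?thesis
  proof
    have op: "open {u. r k u < \<tau> (p k u)}" for k
      by (intro open_Collect_less rc continuous_on_compose2[OF c\<tau> pc]) auto
    have "continuous_on {u. r k u < \<tau> (p k u)} \<Phi>" for k
      by (rule continuous_on_eq[OF continuous_on_subset[OF pc[of "Suc k"]]]) (auto simp: \<Phi>eq)
    then have "continuous_on (\<Union>k. {u. r k u < \<tau> (p k u)}) \<Phi>"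
      using op by (intro continuous_on_open_UN) auto
    moreover have "(\<Union>k. {u. r k u < \<tau> (p k u)}) = UNIV" using N by blast
    ultimately show "continuous_on UNIV \<Phi>" by (simp only:)
    show "\<exists>k. (?S ^^ k) (T, u) = (0, \<Phi> u)" for u
      using stop[OF N[of u], of 0] by (intro exI[of _ "Suc (N u)"]) (simp add: rp \<Phi>_def del: funpow.simps)
  qed
qed

section \<open>Pseudo-gradients and deformation\<close>

lemma almost_norming_vector:
  fixes f :: "'a::real_normed_vector \<Rightarrow>\<^sub>L real"
  assumes "0 \<le> b" "b < norm f"
  obtains v where "norm v \<le> 1" "b < blinfun_apply f v"
proof -
  have "\<exists>x. norm (blinfun_apply f x) > b * norm x"
    using norm_blinfun_bound[OF assms(1), of f] assms(2) by (meson not_le)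
  then obtain x where x: "b * norm x < \<bar>blinfun_apply f x\<bar>" by auto
  then have "x \<noteq> 0" by auto
  define v where "v = (sgn (blinfun_apply f x) / norm x) *\<^sub>R x"
  have "norm v \<le> 1" using \<open>x \<noteq> 0\<close> by (auto simp: v_def sgn_if)
  moreover have "blinfun_apply f v = \<bar>blinfun_apply f x\<bar> / norm x"
    by (simp add: v_def blinfun.scaleR_right abs_sgn)
  ultimately show ?thesis using x \<open>x \<noteq> 0\<close> by (intro that[of v]) (auto simp: pos_less_divide_eq)
qed

text \<open>
  Each vector that nearly realises the norm of \<open>F a\<close> still does so for nearby functionals, and
  the admissible vectors form a closed convex set. Demanding nothing of the vector where
  \<open>norm (F u) < e\<close> makes the selection continuous on the whole space, critical points included.
\<close>

lemma continuous_pseudogradient: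
  fixes F :: "'a::metric_space \<Rightarrow> 'b::banach \<Rightarrow>\<^sub>L real"
  assumes cF: "continuous_on UNIV F" and e: "e > 0"
  obtains W where "continuous_on UNIV W" "\<And>u. norm (W u) \<le> 1"
    "\<And>u. e \<le> norm (F u) \<Longrightarrow> e / 2 \<le> blinfun_apply (F u) (W u)"
proof -
  define \<Phi> where "\<Phi> u = {v. norm v \<le> 1 \<and> (e \<le> norm (F u) \<longrightarrow> e / 2 \<le> blinfun_apply (F u) v)}" for u
  have \<Phi>_alt: "\<Phi> u = cball 0 1 \<inter> (if e \<le> norm (F u) then {v. e / 2 \<le> blinfun_apply (F u) v} else UNIV)" for u
    by (auto simp: \<Phi>_def)
  have cl: "closed {v. e / 2 \<le> blinfun_apply (F u) v}" for u
    by (intro closed_Collect_le continuous_intros)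
  have "linear (blinfun_apply (F u))" for u by (simp add: blinfun.bounded_linear_right bounded_linear.linear)
  then have cv: "convex {v. e / 2 \<le> blinfun_apply (F u) v}" for u
    using convex_linear_vimage[of "blinfun_apply (F u)" "{e / 2..}"] by (simp add: vimage_def)
  show ?thesis
  proof (rule continuous_selection[of \<Phi>])
    show "convex (\<Phi> u)" "closed (\<Phi> u)" for u
      unfolding \<Phi>_alt using cl cv by (auto intro: convex_Int closed_Int)
    show "norm v \<le> 1" if "v \<in> \<Phi> u" for u v using that by (simp add: \<Phi>_def)
    show "\<exists>v. \<exists>r>0. \<forall>u\<in>ball a r. v \<in> \<Phi> u" for a
    proof (cases "norm (F a) < e")
      case True
      have "open {u. norm (F u) < e}" by (intro open_Collect_less continuous_intros cF)
      then obtain r where "r > 0" "ball a r \<subseteq> {u. norm (F u) < e}"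
        by (rule openE[of _ a]) (use True in simp)
      then show ?thesis by (intro exI[of _ 0] exI[of _ r]) (auto simp: \<Phi>_def)
    next
      case False
      then obtain v where v: "norm v \<le> 1" "e / 2 < blinfun_apply (F a) v"
        using almost_norming_vector[of "e / 2" "F a"] e by auto
      have "open {u. e / 2 < blinfun_apply (F u) v}" by (intro open_Collect_less continuous_intros cF)
      then obtain r where "r > 0" "ball a r \<subseteq> {u. e / 2 < blinfun_apply (F u) v}"
        by (rule openE[of _ a]) (use v(2) in simp)
      then show ?thesis using v by (intro exI[of _ v] exI[of _ r]) (auto simp: \<Phi>_def)
    qed
    fix W assume "continuous_on UNIV W" "\<And>u. W u \<in> \<Phi> u"
    then show thesis by (intro that[of W]) (auto simp: \<Phi>_def)
  qed
qed

lemma descent_along_segment: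
  fixes I :: "'a::real_normed_vector \<Rightarrow> real"
  assumes d: "\<And>u. (I has_derivative blinfun_apply (dI u)) (at u)" and s: "0 \<le> s"
    and m: "\<And>t. 0 \<le> t \<Longrightarrow> t \<le> s \<Longrightarrow> m \<le> blinfun_apply (dI (u - t *\<^sub>R v)) v"
  shows "I (u - s *\<^sub>R v) \<le> I u - s * m"
proof -
  have "((\<lambda>t. I (u - t *\<^sub>R v)) has_derivative (\<lambda>h. blinfun_apply (dI (u - t *\<^sub>R v)) (- (h *\<^sub>R v)))) (at t within {0..s})" for t
    by (rule has_derivative_compose[OF _ d, of "\<lambda>t. u - t *\<^sub>R v"]) (auto intro!: derivative_eq_intros)
  from mvt_very_simple[OF s this] obtain t where t: "t \<in> {0..s}"
    "I (u - s *\<^sub>R v) - I u = blinfun_apply (dI (u - t *\<^sub>R v)) (- (s *\<^sub>R v))" by auto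
  then have "I (u - s *\<^sub>R v) - I u = - (s * blinfun_apply (dI (u - t *\<^sub>R v)) v)"
    by (simp add: blinfun.minus_right blinfun.scaleR_right)
  moreover have "s * m \<le> s * blinfun_apply (dI (u - t *\<^sub>R v)) v"
    using t s m by (intro mult_left_mono) auto
  ultimately show ?thesis by simp
qed

text \<open>
  Steepness is only available within distance \<open>T\<close> of the starting set \<open>S\<close> and between the levels
  \<open>lo\<close> and \<open>hi\<close>. The field is switched off below \<open>lo\<close>, so points there do not move, and it has
  norm at most \<open>1\<close>, so in time \<open>T\<close> a point of \<open>S\<close> does not leave the steep region except by
  descending to \<open>lo\<close>. Above \<open>mid\<close> the value drops at rate at least \<open>e / 4\<close>, which in time \<open>T\<close>
  bridges the gap from \<open>hi\<close> to \<open>mid\<close>.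
\<close>

lemma local_deformation:
  fixes I :: "'a::banach \<Rightarrow> real"
  assumes d: "\<And>u. (I has_derivative blinfun_apply (dI u)) (at u)"
    and C1: "continuous_on UNIV dI" and e: "e > 0" and T: "0 \<le> T"
    and lo: "lo < mid" and hi: "hi - T * e / 4 \<le> mid"
    and steep: "\<And>u w. u \<in> S \<Longrightarrow> dist u w \<le> T \<Longrightarrow> lo < I w \<Longrightarrow> I w \<le> hi \<Longrightarrow> e \<le> norm (dI w)"
  obtains \<Phi> where "continuous_on UNIV \<Phi>" "\<And>u. I u \<le> lo \<Longrightarrow> \<Phi> u = u"
    "\<And>u. u \<in> S \<Longrightarrow> I u \<le> hi \<Longrightarrow> I (\<Phi> u) \<le> mid"
proof -
  have Ic: "continuous_on UNIV I"
    using has_derivative_continuous[OF d] by (simp add: continuous_at_imp_continuous_on)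
  obtain W where Wc: "continuous_on UNIV W" and W1: "\<And>u. norm (W u) \<le> 1"
    and WdI: "\<And>u. e \<le> norm (dI u) \<Longrightarrow> e / 2 \<le> blinfun_apply (dI u) (W u)"
    using continuous_pseudogradient[OF C1 e] by blast
  obtain \<tau> where \<tau>c: "continuous_on UNIV \<tau>" and \<tau>0: "\<And>u. 0 < \<tau> u"
    and \<tau>: "\<And>u v. dist u v \<le> \<tau> u \<Longrightarrow> dist (dI u) (dI v) < e / 4"
    using continuous_modulus[OF C1, of "e / 4"] e by auto
  define \<xi> where "\<xi> u = max 0 (min 1 ((I u - lo) / (mid - lo)))" for u
  have \<xi>c: "continuous_on UNIV \<xi>" unfolding \<xi>_def using lo by (intro continuous_intros Ic) auto
  have \<xi>0: "0 \<le> \<xi> u" and \<xi>1: "\<xi> u \<le> 1" for u by (auto simp: \<xi>_def)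
  have \<xi>lo: "\<xi> u = 0" if "I u \<le> lo" for u
    using that lo by (simp add: \<xi>_def divide_nonpos_pos)
  have \<xi>mid: "\<xi> u = 1" if "mid \<le> I u" for u
    using that lo by (simp add: \<xi>_def)
  define V where "V u = \<xi> u *\<^sub>R W u" for u
  have Vapp: "blinfun_apply f (V w) = \<xi> w * blinfun_apply f (W w)" for f :: "'a \<Rightarrow>\<^sub>L real" and w
    by (simp add: V_def blinfun.scaleR_right)
  have Vc: "continuous_on UNIV V" unfolding V_def by (intro continuous_intros \<xi>c Wc)
  have V1: "norm (V u) \<le> 1" for u
    using mult_mono[OF \<xi>1 W1, of u u] \<xi>0[of u] by (simp add: V_def)
  obtain \<Phi> where \<Phi>c: "continuous_on UNIV \<Phi>"
    and \<Phi>: "\<And>u. \<exists>k. (euler_step \<tau> V ^^ k) (T, u) = (0, \<Phi> u)"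
    using euler_polygon_endpoint[OF Vc V1 \<tau>c \<tau>0 T] by blast
  \<comment> \<open>Half of the slope \<open>e / 2\<close> survives along the segment, as \<open>dI\<close> varies by less than \<open>e / 4\<close> on it.\<close>
  have step: "I (w - s *\<^sub>R V w) \<le> I w - s * (\<xi> w * (e / 4))"
    if s: "0 \<le> s" "s \<le> \<tau> w" and steepw: "e \<le> norm (dI w)" for w s
  proof (rule descent_along_segment[OF d s(1)])
    fix t assume t: "0 \<le> t" "t \<le> s"
    let ?z = "w - t *\<^sub>R V w"
    have "dist w ?z \<le> t * 1" using t V1[of w] by (simp add: dist_norm mult_left_le)
    then have "norm (dI w - dI ?z) < e / 4" using \<tau>[of w ?z] t s by (simp add: dist_norm)
    moreover have "blinfun_apply (dI w - dI ?z) (W w) \<le> norm (dI w - dI ?z) * 1"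
      using norm_blinfun[of "dI w - dI ?z" "W w"] mult_left_mono[OF W1[of w] norm_ge_zero[of "dI w - dI ?z"]]
      by (simp add: abs_le_iff)
    ultimately have "e / 4 \<le> blinfun_apply (dI ?z) (W w)"
      using WdI[OF steepw] by (simp add: blinfun.diff_left)
    from mult_left_mono[OF this \<xi>0[of w]]
    show "\<xi> w * (e / 4) \<le> blinfun_apply (dI ?z) (V w)" by (simp only: Vapp)
  qed
  show ?thesis
  proof
    show "continuous_on UNIV \<Phi>" by fact
    show "\<Phi> u = u" if "I u \<le> lo" for u
    proof -
      have "V u = 0" using \<xi>lo[OF that] by (simp add: V_def)
      then have "snd ((euler_step \<tau> V ^^ k) (T, u)) = u" for k
        by (induction k) (auto simp: euler_step_def split: prod.splits)
      then show ?thesis using \<Phi>[of u] by (metis snd_conv)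
    qed
    show "I (\<Phi> u) \<le> mid" if u: "u \<in> S" "I u \<le> hi" for u
    proof -
      have inv: "0 \<le> r \<and> dist u w \<le> T - r \<and> I w \<le> hi \<and> (I w \<le> mid \<or> I w \<le> hi - (T - r) * (e / 4))"
        if "(euler_step \<tau> V ^^ k) (T, u) = (r, w)" for k r w
        using that
      proof (induction k arbitrary: r w)
        case 0 then show ?case using T u by simp
      next
        case (Suc k)
        obtain r' w' where rw': "(euler_step \<tau> V ^^ k) (T, u) = (r', w')" by fastforce
        define h where "h = min r' (\<tau> w')"
        have r: "r = r' - h" and w: "w = w' - h *\<^sub>R V w'"
          using Suc.prems rw' by (simp_all add: euler_step_def h_def)
        have IH: "0 \<le> r'" "dist u w' \<le> T - r'" "I w' \<le> hi"
          "I w' \<le> mid \<or> I w' \<le> hi - (T - r') * (e / 4)" using Suc.IH[OF rw'] by auto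
        have h: "0 \<le> h" "h \<le> r'" "h \<le> \<tau> w'" using IH(1) \<tau>0[of w'] by (auto simp: h_def)
        have "dist w' w \<le> h * 1" using h(1) V1[of w'] by (simp add: w dist_norm mult_left_le)
        then have dist: "dist u w \<le> T - r" using dist_triangle[of u w w'] IH(2) r by simp
        have "I w \<le> hi \<and> (I w \<le> mid \<or> I w \<le> hi - (T - r) * (e / 4))"
        proof (cases "I w' \<le> lo")
          case True
          then have "w = w'" by (simp add: w V_def \<xi>lo)
          then show ?thesis using True lo IH(3) by simp
        next
          case False
          have "e \<le> norm (dI w')" using steep[OF u(1)] IH h False by simp
          then have Iw: "I w \<le> I w' - h * (\<xi> w' * (e / 4))" using step[OF h(1,3)] by (simp add: w)
          moreover have "0 \<le> h * (\<xi> w' * (e / 4))" using h \<xi>0 e by simp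
          ultimately have le: "I w \<le> I w'" by linarith
          show ?thesis
          proof (cases "mid < I w'")
            case True
            have "T - r = (T - r') + h" by (simp add: r)
            then have "(T - r) * (e / 4) = (T - r') * (e / 4) + h * (e / 4)" by (simp only: distrib_right)
            moreover have "I w \<le> I w' - h * (e / 4)" using Iw \<xi>mid[of w'] True by simp
            moreover have "I w' \<le> hi - (T - r') * (e / 4)" using IH(4) True by linarith
            ultimately have "I w \<le> hi - (T - r) * (e / 4)" by linarith
            then show ?thesis using le IH(3) by linarith
          next
            case False then show ?thesis using le IH by simp
          qed
        qed
        then show ?case using dist r h by simp
      qed
      obtain k where "(euler_step \<tau> V ^^ k) (T, u) = (0, \<Phi> u)" using \<Phi> by blast
      then show ?thesis using inv[of k 0 "\<Phi> u"] hi by auto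
    qed
  qed
qed

section \<open>Correcting a map near a compact set\<close>

text \<open>
  The two maps are joined in a thin collar around \<open>M0\<close> by the segment from \<open>f \<circ> \<sigma>\<close> to \<open>g\<close>. These
  are closer than \<open>\<rho>\<close> on \<open>M0\<close>, where \<open>\<sigma>\<close> is the identity, hence on a neighbourhood of
  the compact set \<open>M0\<close>. Since \<open>\<sigma>\<close> retracts the collar into \<open>M0\<close>, all values
  in the collar remain near \<open>f ` M0\<close>.
\<close>

lemma glue_near_compact:
  fixes f g :: "'m::metric_space \<Rightarrow> 'a::real_normed_vector"
  assumes M0: "compact M0" "M0 \<noteq> {}" and e: "\<epsilon> > 0"
    and \<sigma>c: "continuous_on UNIV \<sigma>" and \<sigma>: "\<sigma> ` nbhd M0 \<epsilon> \<subseteq> M0" "\<And>p. p \<in> M0 \<Longrightarrow> \<sigma> p = p"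
    and fc: "continuous_on UNIV f" and gc: "continuous_on UNIV g"
    and near: "\<And>p. p \<in> M0 \<Longrightarrow> norm (g p - f p) < \<rho>"
  obtains \<gamma> where "continuous_on UNIV \<gamma>" "\<And>p. p \<in> M0 \<Longrightarrow> \<gamma> p = f p"
    "\<And>p. \<gamma> p = g p \<or> (\<exists>q\<in>M0. dist (f q) (\<gamma> p) < \<rho>)"
proof -
  have fsc: "continuous_on UNIV (\<lambda>p. f (\<sigma> p))" using continuous_on_compose2[OF fc \<sigma>c] by simp
  let ?U = "{p. norm (g p - f (\<sigma> p)) < \<rho>}"
  have "open ?U" by (intro open_Collect_less continuous_intros gc fsc)
  moreover have "M0 \<subseteq> ?U" using near \<sigma>(2) by auto
  ultimately obtain r0 where r0: "r0 > 0" "(\<Union>q\<in>M0. ball q r0) \<subseteq> ?U"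
    using compact_subset_open_imp_ball_epsilon_subset[OF M0(1)] by blast
  define r where "r = min r0 \<epsilon>"
  have r: "r > 0" using r0 e by (simp add: r_def)
  define \<theta> where "\<theta> p = min 1 (infdist p M0 / r)" for p
  have \<theta>: "0 \<le> \<theta> p" "\<theta> p \<le> 1" for p using r by (auto simp: \<theta>_def infdist_nonneg)
  have \<theta>c: "continuous_on UNIV \<theta>" unfolding \<theta>_def using r by (intro continuous_intros) auto
  define \<gamma> where "\<gamma> p = f (\<sigma> p) + \<theta> p *\<^sub>R (g p - f (\<sigma> p))" for p
  show ?thesis
  proof
    show "continuous_on UNIV \<gamma>" unfolding \<gamma>_def by (intro continuous_intros fsc gc \<theta>c)
    show "\<gamma> p = f p" if "p \<in> M0" for p using that \<sigma>(2) by (simp add: \<gamma>_def \<theta>_def)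
    show "\<gamma> p = g p \<or> (\<exists>q\<in>M0. dist (f q) (\<gamma> p) < \<rho>)" for p
    proof (cases "infdist p M0 < r")
      case False
      then have "\<theta> p = 1" using r by (simp add: \<theta>_def)
      then show ?thesis by (simp add: \<gamma>_def)
    next
      case True
      then obtain q where q: "q \<in> M0" "dist p q < r"
        using cInf_lessD[of "dist p ` M0" r] M0(2) by (auto simp: infdist_def)
      have "dist_set p M0 \<le> ereal (dist p q)" unfolding dist_set_def by (rule INF_lower[OF q(1)])
      also have "\<dots> \<le> ereal \<epsilon>" using q(2) by (simp add: r_def)
      finally have "\<sigma> p \<in> M0" using \<sigma>(1) by (auto simp: nbhd_def)
      moreover have "norm (g p - f (\<sigma> p)) < \<rho>" using q r0(2) by (force simp: r_def dist_commute)
      moreover have "dist (f (\<sigma> p)) (\<gamma> p) = \<theta> p * norm (g p - f (\<sigma> p))"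
        using \<theta>(1)[of p] by (simp add: \<gamma>_def dist_norm)
      moreover have "\<dots> \<le> norm (g p - f (\<sigma> p))" using \<theta>[of p] by (simp add: mult_left_le_one_le)
      ultimately show ?thesis by (metis le_less_trans)
    qed
  qed
qed

section \<open>Bounds for rescaled paths and the minimax theorem\<close>

text \<open>
  The monotonicity trick. Here \<open>a\<close>, \<open>b\<close> are the values of \<open>A\<close>, \<open>B\<close> at a rescaled point and
  \<open>A\<close>, \<open>B\<close> those at the original one. The original point lies below the level
  \<open>c + (\<alpha> - \<beta>)\<close>, which gives \<open>\<alpha> a - \<beta> b \<le> c + (\<alpha> - \<beta>)\<close>. If in addition \<open>a - b\<close> is nearly \<open>c\<close>,
  eliminating \<open>b\<close> leaves \<open>(\<alpha> - \<beta>) a\<close> bounded by a multiple of \<open>\<bar>1 - \<beta>\<bar> + (\<alpha> - \<beta>)\<close>.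
\<close>

lemma rescaled_level_bounds:
  fixes \<alpha> \<beta> :: real
  assumes \<beta>: "0 < \<beta>" "\<beta> < \<alpha>" and a0: "0 \<le> a"
    and a: "\<alpha> * a \<le> A" and b: "B \<le> \<beta> * b" and AB: "A - B \<le> c + (\<alpha> - \<beta>)"
  shows "a - b \<le> (c + (\<alpha> - \<beta>)) / \<beta>"
    and "c - 2 * (\<alpha> - \<beta>) \<le> a - b \<Longrightarrow> a \<le> \<bar>c\<bar> * (\<bar>1 - \<beta>\<bar> / (\<alpha> - \<beta>)) + 1 + 2 * \<beta>"
proof -
  have le: "\<alpha> * a - \<beta> * b \<le> c + (\<alpha> - \<beta>)" using a b AB by linarith
  have "\<beta> * a \<le> \<alpha> * a" using \<beta> a0 by (intro mult_right_mono) auto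
  then have "(a - b) * \<beta> \<le> c + (\<alpha> - \<beta>)" using le by (simp add: algebra_simps)
  then show "a - b \<le> (c + (\<alpha> - \<beta>)) / \<beta>" using \<beta> by (simp add: pos_le_divide_eq)
  assume "c - 2 * (\<alpha> - \<beta>) \<le> a - b"
  then have "\<beta> * (c - 2 * (\<alpha> - \<beta>)) \<le> \<beta> * (a - b)" using \<beta> by (intro mult_left_mono) auto
  then have "(\<alpha> - \<beta>) * a \<le> c * (1 - \<beta>) + (\<alpha> - \<beta>) * (1 + 2 * \<beta>)"
    using le by (simp add: algebra_simps)
  also have "c * (1 - \<beta>) \<le> \<bar>c\<bar> * \<bar>1 - \<beta>\<bar>" by (metis abs_ge_self abs_mult)
  finally have "a \<le> (\<bar>c\<bar> * \<bar>1 - \<beta>\<bar> + (\<alpha> - \<beta>) * (1 + 2 * \<beta>)) / (\<alpha> - \<beta>)"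
    using \<beta> by (simp add: pos_le_divide_eq mult.commute)
  then show "a \<le> \<bar>c\<bar> * (\<bar>1 - \<beta>\<bar> / (\<alpha> - \<beta>)) + 1 + 2 * \<beta>"
    using \<beta> by (simp add: add_divide_distrib)
qed

lemma frequently_less_of_liminf:
  fixes x :: "nat \<Rightarrow> real"
  assumes "liminf (\<lambda>n. ereal (x n)) < \<infinity>"
  obtains C where "0 < C" "\<exists>\<^sub>F n in sequentially. x n < C"
proof -
  obtain C where C: "liminf (\<lambda>n. ereal (x n)) < ereal (real C)"
    using assms less_PInf_Ex_of_nat by auto
  have "\<exists>\<^sub>F n in sequentially. x n < real C + 1"
  proof (rule ccontr)
    assume "\<not> ?thesis"
    then have "\<forall>\<^sub>F n in sequentially. ereal (real C) \<le> ereal (x n)"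
      unfolding frequently_def by (auto elim!: eventually_mono)
    then have "ereal (real C) \<le> liminf (\<lambda>n. ereal (x n))" by (rule Liminf_bounded)
    then show False using C by simp
  qed
  then show ?thesis by (intro that[of "real C + 1"]) auto
qed

theorem theorem2p1:
  fixes I A B :: "'a::banach \<Rightarrow> real"
    and dI :: "'a \<Rightarrow> ('a \<Rightarrow>\<^sub>L real)"
    and \<psi> :: "nat \<Rightarrow> 'a \<Rightarrow> 'a"
    and M0 :: "'m::metric_space set"
    and \<sigma> :: "'m \<Rightarrow> 'm"
    and \<epsilon>0 :: real
    and \<Gamma>0 \<Gamma> :: "('m \<Rightarrow> 'a) set"
    and c :: ereal
  assumes I_deriv: "\<And>u. (I has_derivative blinfun_apply (dI u)) (at u)"
    and I_C1: "continuous_on UNIV dI"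
    and I_eq: "\<And>u. I u = A u - B u"
    and cond_A: "condition_A A"
    and cond_Psi: "condition_Psi A B \<psi>"
    and M0_compact: "compact M0"
    and eps0: "\<epsilon>0 > 0"
    and sigma_cont: "continuous_on UNIV \<sigma>"
    and sigma_unif: "uniformly_continuous_on (nbhd M0 \<epsilon>0) \<sigma>"
    and sigma_into: "\<sigma> ` nbhd M0 \<epsilon>0 \<subseteq> M0"
    and sigma_id: "\<And>p. p \<in> M0 \<Longrightarrow> \<sigma> p = p"
    and Gamma0_sub: "\<Gamma>0 \<subseteq> cont_maps M0"
    and Gamma0_compact: "compact (\<Union>\<gamma>0\<in>\<Gamma>0. \<gamma>0 ` M0)"
    and Gamma_def: "\<Gamma> = extensions M0 \<Gamma>0"
    and c_def: "c = minimax_level I \<Gamma>"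
    and boundary_lt: "(SUP \<gamma>0\<in>\<Gamma>0. SUP u\<in>\<gamma>0 ` M0. ereal (I u)) < c"
    and c_finite: "c < \<infinity>"
    and psi_boundary:
      "(\<lambda>n. SUP \<gamma>0\<in>\<Gamma>0. SUP u\<in>\<gamma>0 ` M0. ereal (norm (\<psi> n u - u))) \<longlonglongrightarrow> 0"
  shows "\<exists>w :: nat \<Rightarrow> 'a.
           (\<lambda>n. ereal (I (w n))) \<longlonglongrightarrow> c \<and>
           (\<lambda>n. dI (w n)) \<longlonglongrightarrow> 0 \<and>
           (SUP n. ereal (A (w n))) < \<infinity>"
proof -
  let ?K = "\<Union>\<gamma>0\<in>\<Gamma>0. \<gamma>0 ` M0"
  have A0: "0 \<le> A u" for u using cond_A by (simp add: condition_A_def)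
  have Ic: "continuous_on UNIV I"
    using has_derivative_continuous[OF I_deriv] by (simp add: continuous_at_imp_continuous_on)
  have \<psi>c: "continuous_on UNIV (\<psi> n)" for n using cond_Psi by (simp add: condition_Psi_def)
  obtain \<alpha> \<beta> :: "nat \<Rightarrow> real" where \<beta>0: "\<And>n. 0 < \<beta> n" and \<beta>\<alpha>: "\<And>n. \<beta> n < \<alpha> n"
    and \<alpha>A: "\<And>n u. \<alpha> n * A (\<psi> n u) \<le> A u" and \<beta>B: "\<And>n u. B u \<le> \<beta> n * B (\<psi> n u)"
    and \<alpha>1: "\<alpha> \<longlonglongrightarrow> 1" and \<beta>1: "\<beta> \<longlonglongrightarrow> 1"
    and liminf: "liminf (\<lambda>n. ereal (\<bar>1 - \<beta> n\<bar> / (\<alpha> n - \<beta> n))) < \<infinity>"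
    using cond_Psi unfolding condition_Psi_def by blast
  obtain C where C: "0 < C" "\<exists>\<^sub>F n in sequentially. \<bar>1 - \<beta> n\<bar> / (\<alpha> n - \<beta> n) < C"
    using frequently_less_of_liminf[OF liminf] by blast
  have mem\<Gamma>: "\<gamma> \<in> \<Gamma> \<longleftrightarrow> continuous_on UNIV \<gamma> \<and> restrict \<gamma> M0 \<in> \<Gamma>0" for \<gamma>
    by (simp add: Gamma_def extensions_def)
  have inK: "\<gamma> p \<in> ?K" if "\<gamma> \<in> \<Gamma>" "p \<in> M0" for \<gamma> p
    using that mem\<Gamma>[of \<gamma>] by (metis UN_I image_eqI restrict_apply')
  obtain cr where cr: "c = ereal cr" using c_finite boundary_lt by (cases c) auto
  have "\<Gamma> \<noteq> {}" using c_finite c_def by (auto simp: minimax_level_def top_ereal_def)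
  then have "\<Gamma>0 \<noteq> {}" using mem\<Gamma> by auto
  have M0_ne: "M0 \<noteq> {}"
  proof
    assume "M0 = {}"
    \<comment> \<open>A supremum over the empty set is \<open>- \<infinity>\<close>, which does not tend to \<open>0\<close>.\<close>
    then have "(\<lambda>n::nat. - \<infinity> :: ereal) \<longlonglongrightarrow> 0"
      using psi_boundary \<open>\<Gamma>0 \<noteq> {}\<close> by (simp add: bot_ereal_def)
    then show False by (simp add: LIMSEQ_const_iff)
  qed
  obtain c0 where c0: "(SUP \<gamma>0\<in>\<Gamma>0. SUP u\<in>\<gamma>0 ` M0. ereal (I u)) < ereal c0" "c0 < cr"
    using ereal_dense2[OF boundary_lt] cr by auto
  have IK: "I u < c0" if "u \<in> ?K" for u
  proof -
    have "ereal (I u) \<le> (SUP \<gamma>0\<in>\<Gamma>0. SUP u\<in>\<gamma>0 ` M0. ereal (I u))"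
      unfolding SUP_UNION[symmetric] by (rule SUP_upper[OF that])
    then show ?thesis using c0(1) by (meson le_less_trans less_ereal.simps(1))
  qed
  have "open {u. I u < c0}" by (intro open_Collect_less Ic continuous_intros)
  then obtain \<rho> where \<rho>: "\<rho> > 0" "(\<Union>u\<in>?K. ball u \<rho>) \<subseteq> {u. I u < c0}"
    using compact_subset_open_imp_ball_epsilon_subset[OF Gamma0_compact] IK by blast
  \<comment> \<open>The bound on \<open>A\<close> at rescaled points near level \<open>c\<close>: quotient below \<open>C\<close> and \<open>\<beta> n < 2\<close>.\<close>
  define K where "K = \<bar>cr\<bar> * C + 5"
  have "K > 0" using C(1) by (simp add: K_def add_nonneg_pos)
  obtain \<delta> where \<delta>: "\<delta> > 0" "\<And>u. dist_set u (sublevel A K) \<le> ereal \<delta> \<Longrightarrow> A u \<le> K + 1"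
    using cond_A \<open>K > 0\<close> unfolding condition_A_def sublevel_def by (metis less_add_one mem_Collect_eq)
  have near_critical: "\<exists>w. \<bar>I w - cr\<bar> < \<epsilon> \<and> norm (dI w) < \<epsilon> \<and> A w \<le> K + 1" if \<epsilon>: "\<epsilon> > 0" for \<epsilon>
  proof (rule ccontr)
    assume "\<not> ?thesis"
    then have steep: "\<epsilon> \<le> norm (dI w)" if "\<bar>I w - cr\<bar> < \<epsilon>" "A w \<le> K + 1" for w
      using that by (meson not_less)
    \<comment> \<open>The level window above \<open>c\<close> must lie in the steep range, be crossed by the descent available
      in time \<open>\<delta>\<close>, and be small against the gap to the boundary values.\<close>
    define \<kappa> where "\<kappa> = min (\<epsilon> / 2) (min (\<delta> * \<epsilon> / 8) ((cr - c0) / 2))"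
    have "0 < \<kappa>" using \<epsilon> \<delta>(1) c0(2) by (simp add: \<kappa>_def)
    moreover have "\<kappa> \<le> \<epsilon> / 2" "\<kappa> \<le> \<delta> * \<epsilon> / 8" "\<kappa> \<le> (cr - c0) / 2"
      unfolding \<kappa>_def by linarith+
    ultimately have \<kappa>: "0 < \<kappa>" "\<kappa> \<le> \<epsilon> / 2" "\<kappa> \<le> \<delta> * \<epsilon> / 8" "\<kappa> \<le> (cr - c0) / 2" by blast+
    have "(\<lambda>n. \<alpha> n - \<beta> n) \<longlonglongrightarrow> 1 - 1" by (intro tendsto_diff \<alpha>1 \<beta>1)
    then have ev1: "\<forall>\<^sub>F n in sequentially. \<alpha> n - \<beta> n < \<kappa>" using \<kappa>(1) by (intro order_tendstoD(2)) auto
    have "(\<lambda>n. (cr + (\<alpha> n - \<beta> n)) / \<beta> n) \<longlonglongrightarrow> (cr + (1 - 1)) / 1" by (intro tendsto_intros \<alpha>1 \<beta>1) auto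
    then have ev2: "\<forall>\<^sub>F n in sequentially. (cr + (\<alpha> n - \<beta> n)) / \<beta> n < cr + \<kappa>"
      using \<kappa>(1) by (intro order_tendstoD(2)) auto
    have ev3: "\<forall>\<^sub>F n in sequentially. \<beta> n < 2" using \<beta>1 by (intro order_tendstoD(2)) auto
    have ev4: "\<forall>\<^sub>F n in sequentially. (SUP \<gamma>0\<in>\<Gamma>0. SUP u\<in>\<gamma>0 ` M0. ereal (norm (\<psi> n u - u))) < ereal \<rho>"
      using psi_boundary \<rho>(1) by (intro order_tendstoD(2)) auto
    obtain n where n: "\<bar>1 - \<beta> n\<bar> / (\<alpha> n - \<beta> n) < C" "\<alpha> n - \<beta> n < \<kappa>"
      "(cr + (\<alpha> n - \<beta> n)) / \<beta> n < cr + \<kappa>" "\<beta> n < 2"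
      "(SUP \<gamma>0\<in>\<Gamma>0. SUP u\<in>\<gamma>0 ` M0. ereal (norm (\<psi> n u - u))) < ereal \<rho>"
      using frequently_ex[OF frequently_eventually_conj[OF C(2) eventually_conj[OF ev1
              eventually_conj[OF ev2 eventually_conj[OF ev3 ev4]]]]] by blast
    define \<eta> where "\<eta> = \<alpha> n - \<beta> n"
    have \<eta>: "0 < \<eta>" "\<eta> < \<kappa>" using \<beta>\<alpha>[of n] n(2) by (auto simp: \<eta>_def)
    have "c < ereal (cr + \<eta>)" unfolding cr using \<eta>(1) by simp
    then obtain \<gamma> where \<gamma>: "\<gamma> \<in> \<Gamma>" "(SUP u\<in>range \<gamma>. ereal (I u)) < ereal (cr + \<eta>)"
      unfolding c_def minimax_level_def INF_less_iff by blast
    have I\<gamma>: "I (\<gamma> p) \<le> cr + \<eta>" for p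
    proof -
      have "ereal (I (\<gamma> p)) \<le> (SUP u\<in>range \<gamma>. ereal (I u))" by (rule SUP_upper) simp
      then show ?thesis using \<gamma>(2) by (meson le_less_trans less_ereal.simps(1) less_imp_le)
    qed
    have \<gamma>c: "continuous_on UNIV \<gamma>" using \<gamma>(1) mem\<Gamma> by blast
    have near: "norm (\<psi> n (\<gamma> p) - \<gamma> p) < \<rho>" if "p \<in> M0" for p
    proof -
      have "ereal (norm (\<psi> n (\<gamma> p) - \<gamma> p))
          \<le> (SUP \<gamma>0\<in>\<Gamma>0. SUP u\<in>\<gamma>0 ` M0. ereal (norm (\<psi> n u - u)))"
        unfolding SUP_UNION[symmetric] by (rule SUP_upper[OF inK[OF \<gamma>(1) that]])
      then show ?thesis using n(5) by (meson le_less_trans less_ereal.simps(1))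
    qed
    have \<psi>\<gamma>: "I (\<psi> n (\<gamma> p)) \<le> cr + \<kappa>"
      "cr - 2 * \<eta> \<le> I (\<psi> n (\<gamma> p)) \<Longrightarrow> A (\<psi> n (\<gamma> p)) \<le> K" for p
    proof -
      have le: "A (\<gamma> p) - B (\<gamma> p) \<le> cr + (\<alpha> n - \<beta> n)" using I\<gamma>[of p] by (simp add: I_eq \<eta>_def)
      note b = rescaled_level_bounds[OF \<beta>0[of n] \<beta>\<alpha>[of n] A0 \<alpha>A[of n "\<gamma> p"] \<beta>B[of "\<gamma> p" n] le]
      show "I (\<psi> n (\<gamma> p)) \<le> cr + \<kappa>" using b(1) n(3) by (simp add: I_eq)
      assume "cr - 2 * \<eta> \<le> I (\<psi> n (\<gamma> p))"
      then have "A (\<psi> n (\<gamma> p)) \<le> \<bar>cr\<bar> * (\<bar>1 - \<beta> n\<bar> / (\<alpha> n - \<beta> n)) + 1 + 2 * \<beta> n"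
        using b(2) by (simp add: I_eq \<eta>_def)
      also have "\<dots> \<le> \<bar>cr\<bar> * C + 1 + 2 * 2"
        using n(1,4) by (intro add_mono mult_left_mono) auto
      finally show "A (\<psi> n (\<gamma> p)) \<le> K" by (simp add: K_def)
    qed
    \<comment> \<open>The rescaled path need not have boundary values in \<open>\<Gamma>0\<close>; those of \<open>\<gamma>\<close> are restored.\<close>
    obtain \<gamma>' where \<gamma>': "continuous_on UNIV \<gamma>'" "\<And>p. p \<in> M0 \<Longrightarrow> \<gamma>' p = \<gamma> p"
      "\<And>p. \<gamma>' p = \<psi> n (\<gamma> p) \<or> (\<exists>q\<in>M0. dist (\<gamma> q) (\<gamma>' p) < \<rho>)"
      using glue_near_compact[OF M0_compact M0_ne eps0 sigma_cont sigma_into sigma_id \<gamma>c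
          continuous_on_compose2[OF \<psi>c \<gamma>c] near] by auto
    have "\<epsilon> \<le> norm (dI w)"
      if "u \<in> sublevel A K" "dist u w \<le> \<delta>" "cr - 2 * \<eta> < I w" "I w \<le> cr + \<kappa>" for u w
    proof (rule steep)
      have "dist_set w (sublevel A K) \<le> ereal (dist w u)"
        unfolding dist_set_def by (rule INF_lower[OF that(1)])
      also have "\<dots> \<le> ereal \<delta>" using that(2) by (simp add: dist_commute)
      finally show "A w \<le> K + 1" by (rule \<delta>(2))
      show "\<bar>I w - cr\<bar> < \<epsilon>" using that(3,4) \<kappa> \<eta> \<epsilon> by linarith
    qed
    moreover have "cr - 2 * \<eta> < cr - \<eta>" "cr + \<kappa> - \<delta> * \<epsilon> / 4 \<le> cr - \<eta>" using \<kappa> \<eta> by linarith+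
    ultimately obtain \<Phi> where \<Phi>: "continuous_on UNIV \<Phi>" "\<And>u. I u \<le> cr - 2 * \<eta> \<Longrightarrow> \<Phi> u = u"
      "\<And>u. u \<in> sublevel A K \<Longrightarrow> I u \<le> cr + \<kappa> \<Longrightarrow> I (\<Phi> u) \<le> cr - \<eta>"
      using local_deformation[OF I_deriv I_C1 \<epsilon> less_imp_le[OF \<delta>(1)], of "cr - 2 * \<eta>" "cr - \<eta>" "cr + \<kappa>" "sublevel A K"]
      by blast
    have "\<eta> < (cr - c0) / 2" by (rule less_le_trans[OF \<eta>(2) \<kappa>(4)])
    then have c0lo: "c0 \<le> cr - 2 * \<eta>" by (simp add: less_divide_eq)
    \<comment> \<open>Points with low values are fixed; every other point is a rescaled point with \<open>A\<close> at most \<open>K\<close>.\<close>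
    have low: "I (\<Phi> (\<gamma>' p)) \<le> cr - \<eta>" for p
    proof (cases "I (\<gamma>' p) \<le> cr - 2 * \<eta>")
      case True
      then show ?thesis using \<Phi>(2) \<eta>(1) by simp
    next
      case False
      have "\<not> dist (\<gamma> q) (\<gamma>' p) < \<rho>" if "q \<in> M0" for q
        using \<rho>(2) inK[OF \<gamma>(1) that] False c0lo by (force simp: subset_eq)
      then have eq: "\<gamma>' p = \<psi> n (\<gamma> p)" using \<gamma>'(3)[of p] by blast
      show ?thesis using \<psi>\<gamma>[of p] False unfolding eq by (intro \<Phi>(3)) (auto simp: sublevel_def)
    qed
    have "\<Phi> (\<gamma>' p) = \<gamma> p" if "p \<in> M0" for p
      using \<Phi>(2)[of "\<gamma> p"] IK[OF inK[OF \<gamma>(1) that]] c0lo \<gamma>'(2)[OF that] by simp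
    then have "restrict (\<lambda>p. \<Phi> (\<gamma>' p)) M0 = restrict \<gamma> M0" by (auto simp: restrict_def)
    then have "(\<lambda>p. \<Phi> (\<gamma>' p)) \<in> \<Gamma>"
      using continuous_on_compose2[OF \<Phi>(1) \<gamma>'(1)] \<gamma>(1) by (simp add: mem\<Gamma>)
    then have "c \<le> (SUP u\<in>range (\<lambda>p. \<Phi> (\<gamma>' p)). ereal (I u))"
      unfolding c_def minimax_level_def by (rule INF_lower)
    also have "\<dots> \<le> ereal (cr - \<eta>)" using low by (intro SUP_least) auto
    finally show False using cr \<eta>(1) by simp
  qed
  have "\<exists>w. \<bar>I w - cr\<bar> < inverse (real (Suc n)) \<and> norm (dI w) < inverse (real (Suc n)) \<and> A w \<le> K + 1" for n
    by (rule near_critical) simp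
  then obtain w where w: "\<And>n. \<bar>I (w n) - cr\<bar> < inverse (real (Suc n))"
    "\<And>n. norm (dI (w n)) < inverse (real (Suc n))" "\<And>n. A (w n) \<le> K + 1" by metis
  have "(\<lambda>n. I (w n) - cr) \<longlonglongrightarrow> 0"
    by (rule Lim_null_comparison[OF _ LIMSEQ_inverse_real_of_nat])
       (use w(1) in \<open>auto intro!: always_eventually less_imp_le\<close>)
  then have "(\<lambda>n. ereal (I (w n))) \<longlonglongrightarrow> c" by (simp add: cr LIM_zero_iff)
  moreover have "(\<lambda>n. dI (w n)) \<longlonglongrightarrow> 0"
    by (rule Lim_null_comparison[OF _ LIMSEQ_inverse_real_of_nat])
       (use w(2) in \<open>auto intro!: always_eventually less_imp_le\<close>)
  moreover have "(SUP n. ereal (A (w n))) \<le> ereal (K + 1)" using w(3) by (intro SUP_least) simp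
  then have "(SUP n. ereal (A (w n))) < \<infinity>" by (rule le_less_trans) simp
  ultimately show ?thesis by blast
qed

end
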